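(* Fix a real $q\ge 1$. The convex relaxation (P) for the minimum $\ell_q$ disagreements problem has an integrality gap of $\Omega(n^{\frac{1}{2} - \frac{1}{2q}})$ on arbitrary graphs; that is, there exist instances on $n$ vertices (for arbitrarily large $n$) whose optimal integral objective value is at least $c\, n^{\frac{1}{2}-\frac{1}{2q}}$ times the optimal value of (P), for an absolute constant $c>0$.
   Context: An instance of the minimum $\ell_q$ disagreements problem consists of a vertex set $V$ with $|V|=n$, disjoint sets $E^+$, $E^-$ of unordered pairs of distinct vertices, and nonnegative weights $w_{uv}$. For a partition $\mathcal{P}$ of $V$, a positive edge is in disagreement if its endpoints are in different parts, a negative edge if its endpoints are in the same part; $\mathrm{disagree}_u=\sum_{v:(u,v)\in E^+\cup E^-} w_{uv}\mathbf{1}((u,v)\text{ in disagreement})$, and the objective is $\min_{\mathcal{P}}\|\mathrm{disagree}(\mathcal{P})\|_q$. The relaxation (P) has variables $x_{uv}$ for $u,v\in V$ and $y_u,z_u$ for $u\in V$, and is: minimize $\max\big(\|y\|_q, (\sum_{u\in V} z_u)^{1/q}\big)$ subject to $y_u=\sum_{v:(u,v)\in E^+} w_{uv}x_{uv}+\sum_{v:(u,v)\in E^-} w_{uv}(1-x_{uv})$ and $z_u=\sum_{v:(u,v)\in E^+} w_{uv}^q x_{uv}+\sum_{v:(u,v)\in E^-} w^q_{uv}(1-x_{uv})$ for all $u$; $x_{v_1v_2}+x_{v_2v_3}\ge x_{v_1v_3}$ for all $v_1,v_2,v_3\in V$; $x_{uv}=x_{vu}$ and $x_{uv}\in[0,1]$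 for all $u,v$. The integrality gap is the supremum over instances of the ratio of the optimal integral objective to the optimal value of (P). *)

theory Defs
  imports Complex_Main "HOL-Library.Disjoint_Sets" "HOL-Library.Extended_Real"
begin

record 'a disagree_instance =
  verts :: "'a set"
  pos_edges :: "'a set set"
  neg_edges :: "'a set set"
  weight :: "'a set \<Rightarrow> real"

definition valid_instance :: "'a disagree_instance \<Rightarrow> bool" where
  "valid_instance I \<longleftrightarrow>
     finite (verts I) \<and>
     pos_edges I \<subseteq> {{u, v} | u v. u \<in> verts I \<and> v \<in> verts I \<and> u \<noteq> v} \<and>
     neg_edges I \<subseteq> {{u, v} | u v. u \<in> verts I \<and> v \<in> verts I \<and> u \<noteq> v} \<and>
     pos_edges I \<inter> neg_edges I = {} \<and>
     (\<forall>e \<in> pos_edges I \<union> neg_edges I. 0 \<le> weight I e)"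

definition pos_nbrs :: "'a disagree_instance \<Rightarrow> 'a \<Rightarrow> 'a set" where
  "pos_nbrs I u = {v \<in> verts I. {u, v} \<in> pos_edges I}"

definition neg_nbrs :: "'a disagree_instance \<Rightarrow> 'a \<Rightarrow> 'a set" where
  "neg_nbrs I u = {v \<in> verts I. {u, v} \<in> neg_edges I}"

definition lq_norm :: "real \<Rightarrow> 'a set \<Rightarrow> ('a \<Rightarrow> real) \<Rightarrow> real" where
  "lq_norm q V f = (\<Sum>u\<in>V. \<bar>f u\<bar> powr q) powr (1 / q)"

definition same_part :: "'a set set \<Rightarrow> 'a \<Rightarrow> 'a \<Rightarrow> bool" where
  "same_part P u v \<longleftrightarrow> (\<exists>C\<in>P. u \<in> C \<and> v \<in> C)"

definition in_disagreement :: "'a disagree_instance \<Rightarrow> 'a set set \<Rightarrow> 'a \<Rightarrow> 'a \<Rightarrow> bool" where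
  "in_disagreement I P u v \<longleftrightarrow>
     {u, v} \<in> pos_edges I \<and> \<not> same_part P u v \<or>
     {u, v} \<in> neg_edges I \<and> same_part P u v"

definition disagree :: "'a disagree_instance \<Rightarrow> 'a set set \<Rightarrow> 'a \<Rightarrow> real" where
  "disagree I P u =
     (\<Sum>v \<in> pos_nbrs I u \<union> neg_nbrs I u. weight I {u, v} * of_bool (in_disagreement I P u v))"

definition integral_opt :: "real \<Rightarrow> 'a disagree_instance \<Rightarrow> real" where
  "integral_opt q I =
     Min {lq_norm q (verts I) (disagree I P) | P. partition_on (verts I) P}"

definition feasible ::
  "real \<Rightarrow> 'a disagree_instance \<Rightarrow> ('a \<Rightarrow> 'a \<Rightarrow> real) \<Rightarrow> ('a \<Rightarrow> real) \<Rightarrow> ('a \<Rightarrow> real) \<Rightarrow> bool" where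
  "feasible q I x y z \<longleftrightarrow>
     (\<forall>u\<in>verts I. y u = (\<Sum>v\<in>pos_nbrs I u. weight I {u, v} * x u v)
                      + (\<Sum>v\<in>neg_nbrs I u. weight I {u, v} * (1 - x u v))) \<and>
     (\<forall>u\<in>verts I. z u = (\<Sum>v\<in>pos_nbrs I u. weight I {u, v} powr q * x u v)
                      + (\<Sum>v\<in>neg_nbrs I u. weight I {u, v} powr q * (1 - x u v))) \<and>
     (\<forall>v1\<in>verts I. \<forall>v2\<in>verts I. \<forall>v3\<in>verts I. x v1 v2 + x v2 v3 \<ge> x v1 v3) \<and>
     (\<forall>u\<in>verts I. \<forall>v\<in>verts I. x u v = x v u) \<and>
     (\<forall>u\<in>verts I. \<forall>v\<in>verts I. x u v \<in> {0..1})"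

definition relaxation_opt :: "real \<Rightarrow> 'a disagree_instance \<Rightarrow> real" where
  "relaxation_opt q I =
     Inf {max (lq_norm q (verts I) y) ((\<Sum>u\<in>verts I. z u) powr (1 / q)) | x y z.
            feasible q I x y z}"

text \<open>
  The supremum of the ratios over the instances on n vertices. Every finite instance is
  isomorphic to one whose vertices are natural numbers. Instances with relaxation value 0 are
  left out: their ratio is the undefined 0/0.
\<close>
definition integrality_gap :: "real \<Rightarrow> nat \<Rightarrow> ereal" where
  "integrality_gap q n =
     (SUP I \<in> {I :: nat disagree_instance.
                 valid_instance I \<and> card (verts I) = n \<and> 0 < relaxation_opt q I}.
        ereal (integral_opt q I / relaxation_opt q I))"

end

theory Submission
  imports Defs
begin

text \<open>
  Take m layers of m vertices each, with unit weight positive edges between any two vertices of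
  consecutive layers and unit weight negative edges between the first and the last layer. Spreading
  the layers evenly over [0, 1] gives every vertex a fractional disagreement of at most
  2m / (m - 1), so the relaxation value is at most of order n powr (1 / q).

  Integrally, at least m / 2 vertices have disagreement at least m / 2. Otherwise every layer
  consists mostly of good vertices, and a good vertex shares its part with most of the next layer,
  hence with a good vertex there. Following such vertices through all layers, some good vertex of
  the first layer shares its part with most of the last layer, contradicting its goodness. So the
  integral optimum is at least of order m powr (1 + 1 / q), while n = m * m.
\<close>

section \<open>The layered instance\<close>

text \<open>Vertex \<open>u\<close> lies in layer \<open>u div m\<close>; the vertices are natural
  numbers because \<open>integrality_gap\<close> ranges over such instances.\<close>

definition layered_instance :: "nat \<Rightarrow> nat disagree_instance" where
  "layered_instance m =
     \<lparr>verts = {..<m * m},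
      pos_edges = {{u, v} | u v. u < m * m \<and> v < m * m \<and> v div m = Suc (u div m)},
      neg_edges = {{u, v} | u v. u < m * m \<and> v < m * m \<and> u div m = 0 \<and> v div m = m - 1},
      weight = (\<lambda>_. 1)\<rparr>"

lemma verts_layered [simp]: "verts (layered_instance m) = {..<m * m}"
  and weight_layered [simp]: "weight (layered_instance m) e = 1"
  by (simp_all add: layered_instance_def)

lemma pos_edges_layered:
  "{u, v} \<in> pos_edges (layered_instance m) \<longleftrightarrow>
     u < m * m \<and> v < m * m \<and> (v div m = Suc (u div m) \<or> u div m = Suc (v div m))"
  by (auto simp: layered_instance_def doubleton_eq_iff)

lemma neg_edges_layered:
  "{u, v} \<in> neg_edges (layered_instance m) \<longleftrightarrow>
     u < m * m \<and> v < m * m \<and>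
     (u div m = 0 \<and> v div m = m - 1 \<or> v div m = 0 \<and> u div m = m - 1)"
  by (auto simp: layered_instance_def doubleton_eq_iff)

lemma card_layer:
  assumes "i < m"
  shows "card {v. v < m * m \<and> v div m = i} = m"
proof -
  have "{v. v < m * m \<and> v div m = i} = {i * m..<i * m + m}"
  proof (intro set_eqI iffI)
    fix v assume "v \<in> {i * m..<i * m + m}"
    then have v: "i * m \<le> v" "v < Suc i * m" by auto
    have "Suc i * m \<le> m * m"
      using assms by (intro mult_right_mono) auto
    moreover have "v div m = i"
      using v by (intro div_nat_eqI) (auto simp: mult.commute)
    ultimately show "v \<in> {v. v < m * m \<and> v div m = i}"
      using v by auto
  next
    fix v assume "v \<in> {v. v < m * m \<and> v div m = i}"
    then have "v div m = i" by simp
    moreover have "v = m * (v div m) + v mod m" by simp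
    moreover have "v mod m < m" using assms by simp
    ultimately show "v \<in> {i * m..<i * m + m}"
      by (auto simp: mult.commute)
  qed
  then show ?thesis by simp
qed

text \<open>Positive edges join layers at index distance 1, negative edges layers at distance
  \<open>m - 1\<close>, which is at least 2. Hence no edge has both signs and no edge is a
  loop.\<close>

lemma valid_layered:
  assumes "3 \<le> m"
  shows "valid_instance (layered_instance m)"
proof -
  have "pos_edges (layered_instance m) \<inter> neg_edges (layered_instance m) = {}"
  proof (rule equals0I)
    fix e assume e: "e \<in> pos_edges (layered_instance m) \<inter> neg_edges (layered_instance m)"
    then obtain u v where "e = {u, v}"
      by (auto simp: layered_instance_def)
    with e show False
      using assms by (auto simp: pos_edges_layered neg_edges_layered)
  qed
  moreover have "pos_edges (layered_instance m) \<union> neg_edges (layered_instance m)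
      \<subseteq> {{u, v} | u v. u \<in> {..<m * m} \<and> v \<in> {..<m * m} \<and> u \<noteq> v}"
  proof
    fix e assume "e \<in> pos_edges (layered_instance m) \<union> neg_edges (layered_instance m)"
    then obtain u v where e: "e = {u, v}" "u < m * m" "v < m * m" "u div m \<noteq> v div m"
      using assms unfolding layered_instance_def by fastforce
    then have "u \<noteq> v" by blast
    with e show "e \<in> {{u, v} | u v. u \<in> {..<m * m} \<and> v \<in> {..<m * m} \<and> u \<noteq> v}"
      by blast
  qed
  ultimately show ?thesis
    by (simp add: valid_instance_def)
qed

section \<open>Lower bound on the integral optimum\<close>

text \<open>Unit weights make \<open>disagree\<close> a count, and a vertex in disagreement with
  \<open>u\<close> is always a neighbour of \<open>u\<close>.\<close>

lemma disagree_layered_ge: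
  assumes "S \<subseteq> {v. v < m * m \<and> in_disagreement (layered_instance m) P u v}"
  shows "real (card S) \<le> disagree (layered_instance m) P u"
proof -
  let ?I = "layered_instance m"
  let ?N = "pos_nbrs ?I u \<union> neg_nbrs ?I u"
  have S: "S \<subseteq> {v \<in> ?N. in_disagreement ?I P u v}"
    using assms by (auto simp: pos_nbrs_def neg_nbrs_def in_disagreement_def)
  have fin: "finite ?N"
    by (auto simp: pos_nbrs_def neg_nbrs_def)
  have "card S \<le> card {v \<in> ?N. in_disagreement ?I P u v}"
    using S fin by (intro card_mono) auto
  also have "real \<dots> = (\<Sum>v\<in>{v \<in> ?N. in_disagreement ?I P u v}. 1)"
    by simp
  also have "\<dots> = disagree ?I P u"
    unfolding disagree_def using fin
    by (intro sum.mono_neutral_cong_left) auto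
  finally show ?thesis by simp
qed

lemma same_part_trans:
  assumes "partition_on V P" "same_part P u v" "same_part P v w"
  shows "same_part P u w"
proof -
  obtain C D where CD: "C \<in> P" "u \<in> C" "v \<in> C" "D \<in> P" "v \<in> D" "w \<in> D"
    using assms(2,3) by (auto simp: same_part_def)
  have "C = D"
    using assms(1) CD by (auto simp: partition_on_def disjoint_def)
  with CD show ?thesis by (auto simp: same_part_def)
qed

lemma many_bad_vertices:
  assumes m: "3 \<le> m" and P: "partition_on {..<m * m} P"
  shows "m \<le> 2 * card {u. u < m * m \<and> real m / 2 \<le> disagree (layered_instance m) P u}"
    (is "m \<le> 2 * card ?B")
proof (rule ccontr)
  assume "\<not> ?thesis"
  then have B: "2 * card ?B < m" by simp
  let ?I = "layered_instance m"
  let ?L = "\<lambda>i. {v. v < m * m \<and> v div m = i}"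
  \<comment> \<open>Every vertex of the next layer outside the part of \<open>u\<close> gives a
    positive edge in disagreement at \<open>u\<close>, and \<open>u\<close> is good.\<close>
  have next_layer: "2 * card {v \<in> ?L (Suc i). \<not> same_part P u v} < m"
    if u: "u \<in> ?L i - ?B" for u i
  proof -
    have "real (card {v \<in> ?L (Suc i). \<not> same_part P u v}) \<le> disagree ?I P u"
      using u by (intro disagree_layered_ge) (auto simp: in_disagreement_def pos_edges_layered)
    also have "\<dots> < real m / 2" using u by auto
    finally show ?thesis by linarith
  qed
  have "\<not> ?L 0 \<subseteq> ?B"
    using card_mono[of ?B "?L 0"] card_layer[of 0 m] m B by auto
  then obtain a where a: "a \<in> ?L 0 - ?B" by auto
  \<comment> \<open>The invariant keeps \<open>u\<close> good, so that \<open>next_layer\<close>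
    applies again, and ties it to the fixed vertex \<open>a\<close>, at which the negative edges are
    counted in the end.\<close>
  have reach: "\<exists>u \<in> ?L i - ?B. same_part P a u" if "i < m" for i
    using that
  proof (induction i)
    case 0
    have "same_part P a a"
      using a P by (auto simp: partition_on_def same_part_def)
    with a show ?case by blast
  next
    case (Suc i)
    then obtain u where u: "u \<in> ?L i - ?B" "same_part P a u" by auto
    let ?D = "{v \<in> ?L (Suc i). \<not> same_part P u v}"
    \<comment> \<open>Two sets of fewer than \<open>m / 2\<close> vertices each cannot cover a layer
      of \<open>m\<close> vertices.\<close>
    have "\<not> ?L (Suc i) \<subseteq> ?D \<union> ?B"
    proof
      assume "?L (Suc i) \<subseteq> ?D \<union> ?B"
      then have "m \<le> card (?D \<union> ?B)"
        using card_mono[of "?D \<union> ?B" "?L (Suc i)"] card_layer[OF Suc.prems] by simp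
      also have "\<dots> \<le> card ?D + card ?B" by (rule card_Un_le)
      finally show False using next_layer[OF u(1)] B by linarith
    qed
    then obtain v where "v \<in> ?L (Suc i) - ?B" "same_part P u v" by auto
    with u(2) P show ?case by (blast intro: same_part_trans)
  qed
  \<comment> \<open>The walk stops one layer early: from the last layer a majority is needed, not
    just one good vertex.\<close>
  obtain u where u: "u \<in> ?L (m - 2) - ?B" "same_part P a u"
    using reach[of "m - 2"] m by auto
  have last: "Suc (m - 2) = m - 1" using m by simp
  let ?D = "{v \<in> ?L (m - 1). \<not> same_part P u v}"
  let ?S = "{v \<in> ?L (m - 1). same_part P u v}"
  have "m = card (?L (m - 1))" using card_layer[of "m - 1" m] m by simp
  also have "?L (m - 1) = ?D \<union> ?S" by blast
  also have "card \<dots> \<le> card ?D + card ?S" by (rule card_Un_le)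
  finally have "m \<le> card ?D + card ?S" .
  moreover have "2 * card ?D < m"
    using next_layer[OF u(1)] by (simp only: last)
  ultimately have "m < 2 * card ?S" by linarith
  \<comment> \<open>By transitivity through \<open>u\<close>, all of \<open>?S\<close> shares the
    part of \<open>a\<close>, so each of its vertices is the end of a negative edge in disagreement
    at \<open>a\<close>.\<close>
  moreover have "real (card ?S) \<le> disagree ?I P a"
    using a u(2) same_part_trans[OF P]
    by (intro disagree_layered_ge) (auto simp: in_disagreement_def neg_edges_layered)
  moreover have "disagree ?I P a < real m / 2" using a by auto
  ultimately show False by linarith
qed

text \<open>The bad vertices alone contribute at least \<open>m / 2\<close> terms of size at least
  \<open>(m / 2) powr q\<close> to the sum under the root.\<close>

lemma lq_norm_disagree_layered_ge:
  assumes m: "3 \<le> m" and P: "partition_on {..<m * m} P" and q: "1 \<le> q"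
  shows "real m powr (1 + 1 / q) / 4 \<le> lq_norm q {..<m * m} (disagree (layered_instance m) P)"
proof -
  let ?d = "disagree (layered_instance m) P"
  define B where "B = {u. u < m * m \<and> real m / 2 \<le> ?d u}"
  have "real m / 2 \<le> card B"
    using many_bad_vertices[OF m P] unfolding B_def by linarith
  then have "(real m / 2) powr (1 + q) \<le> real (card B) * (real m / 2) powr q"
    using m by (simp add: powr_add mult_right_mono)
  also have "\<dots> = (\<Sum>u\<in>B. (real m / 2) powr q)" by simp
  also have "\<dots> \<le> (\<Sum>u\<in>B. \<bar>?d u\<bar> powr q)"
    using q by (intro sum_mono powr_mono2) (auto simp: B_def)
  also have "\<dots> \<le> (\<Sum>u<m * m. \<bar>?d u\<bar> powr q)"
    by (intro sum_mono2) (auto simp: B_def)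
  finally have "((real m / 2) powr (1 + q)) powr (1 / q) \<le> lq_norm q {..<m * m} ?d"
    unfolding lq_norm_def using q by (intro powr_mono2) auto
  moreover have "(real m / 2) powr (1 + 1 / q) = ((real m / 2) powr (1 + q)) powr (1 / q)"
    using q by (simp add: powr_powr add_divide_distrib add.commute)
  moreover have "real m powr (1 + 1 / q) / 4 \<le> (real m / 2) powr (1 + 1 / q)"
  proof -
    \<comment> \<open>Since \<open>1 / q\<close> is at most 1, the lost factor is at most 4 for
      every \<open>q\<close>, which keeps the final constant absolute.\<close>
    have "2 powr (1 + 1 / q) \<le> 2 powr (2 :: real)"
      using q by (intro powr_mono) auto
    then have "2 powr (1 + 1 / q) \<le> (4 :: real)" by simp
    then have "real m powr (1 + 1 / q) / 4 \<le> real m powr (1 + 1 / q) / 2 powr (1 + 1 / q)"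
      by (intro divide_left_mono) auto
    then show ?thesis by (simp add: powr_divide)
  qed
  ultimately show ?thesis by simp
qed

lemma integral_opt_layered_ge:
  assumes m: "3 \<le> m" and q: "1 \<le> q"
  shows "real m powr (1 + 1 / q) / 4 \<le> integral_opt q (layered_instance m)"
proof -
  let ?V = "{..<m * m}"
  let ?S = "{lq_norm q ?V (disagree (layered_instance m) P) | P. partition_on ?V P}"
  \<comment> \<open>\<open>Min\<close> needs a finite nonempty set: there are finitely many
    partitions, and the one into singletons exists.\<close>
  have "{P. partition_on ?V P} \<subseteq> Pow (Pow ?V)"
    by (auto simp: partition_on_def)
  then have "finite {P. partition_on ?V P}"
    by (rule finite_subset) simp
  then have "finite ?S" by (simp add: setcompr_eq_image)
  moreover have "partition_on ?V ((\<lambda>v. {v}) ` ?V)"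
    by (auto simp: partition_on_def disjoint_def)
  then have "?S \<noteq> {}" by blast
  ultimately show ?thesis
    unfolding integral_opt_def verts_layered
    using lq_norm_disagree_layered_ge[OF m _ q] by (subst Min_ge_iff) blast+
qed

section \<open>Bounds on the relaxation value\<close>

lemma member_le_lq_norm:
  assumes "finite V" "u \<in> V" "0 < q"
  shows "\<bar>f u\<bar> \<le> lq_norm q V f"
proof -
  have "\<bar>f u\<bar> powr q \<le> (\<Sum>v\<in>V. \<bar>f v\<bar> powr q)"
    using assms by (intro member_le_sum) auto
  then have "(\<bar>f u\<bar> powr q) powr (1 / q) \<le> lq_norm q V f"
    unfolding lq_norm_def using assms by (intro powr_mono2) auto
  then show ?thesis using assms by (simp add: powr_powr)
qed

text \<open>A path of \<open>m - 1\<close> positive edges from the first to the last layer is closed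
  by a negative edge. By the triangle inequality the fractional costs on this cycle of
  \<open>m\<close> edges sum to at least 1, while each is at most the norm of \<open>y\<close>. The
  bound serves to show that the relaxation value is positive.\<close>

lemma feasible_layered_ge:
  assumes m: "3 \<le> m" and q: "1 \<le> q" and feas: "feasible q (layered_instance m) x y z"
  shows "1 / real m \<le> lq_norm q {..<m * m} y"
proof -
  let ?I = "layered_instance m"
  let ?V = "{..<m * m}"
  define e where "e = lq_norm q ?V y"
  have tri: "x u w \<le> x u v + x v w" if "u \<in> ?V" "v \<in> ?V" "w \<in> ?V" for u v w
    using feas that by (auto simp: feasible_def)
  have x01: "0 \<le> x u v" "x u v \<le> 1" if "u \<in> ?V" "v \<in> ?V" for u v
    using feas that by (auto simp: feasible_def)
  have y: "y u = (\<Sum>v\<in>pos_nbrs ?I u. x u v) + (\<Sum>v\<in>neg_nbrs ?I u. 1 - x u v)" if "u \<in> ?V" for u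
    using feas that by (auto simp: feasible_def)
  have fin: "finite (pos_nbrs ?I u)" "finite (neg_nbrs ?I u)" for u
    by (auto simp: pos_nbrs_def neg_nbrs_def)
  have y_le: "y u \<le> e" if "u \<in> ?V" for u
    using member_le_lq_norm[of ?V u q y] that q by (simp add: e_def)
  have nonneg: "0 \<le> (\<Sum>v\<in>pos_nbrs ?I u. x u v)" "0 \<le> (\<Sum>v\<in>neg_nbrs ?I u. 1 - x u v)"
    if "u \<in> ?V" for u
    using that by (auto intro!: sum_nonneg x01 simp: pos_nbrs_def neg_nbrs_def)
  \<comment> \<open>All terms of \<open>y u\<close> are nonnegative, so the cost of a single edge is
    at most \<open>y u\<close>, hence at most \<open>e\<close>.\<close>
  have pos: "x u v \<le> e" if "u \<in> ?V" "v \<in> pos_nbrs ?I u" for u v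
  proof -
    have "x u v \<le> (\<Sum>v\<in>pos_nbrs ?I u. x u v)"
      using that fin by (intro member_le_sum) (auto simp: pos_nbrs_def intro!: x01)
    with y_le[of u] y[of u] nonneg[of u] that show ?thesis by simp
  qed
  have neg: "1 - x u v \<le> e" if "u \<in> ?V" "v \<in> neg_nbrs ?I u" for u v
  proof -
    have "1 - x u v \<le> (\<Sum>v\<in>neg_nbrs ?I u. 1 - x u v)"
      using that fin by (intro member_le_sum) (auto simp: neg_nbrs_def intro!: x01)
    with y_le[of u] y[of u] nonneg[of u] that show ?thesis by simp
  qed
  \<comment> \<open>The path uses \<open>i * m\<close>, the first vertex of layer
    \<open>i\<close>.\<close>
  have V: "i * m \<in> ?V" if "i < m" for i using that m by simp
  have edge: "x (i * m) (Suc i * m) \<le> e" if "Suc i < m" for i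
  proof (rule pos)
    show "i * m \<in> ?V" using that m by simp
    show "Suc i * m \<in> pos_nbrs ?I (i * m)"
      unfolding pos_nbrs_def pos_edges_layered
      using that m V[of i] V[of "Suc i"] by (simp del: mult_Suc)
  qed
  have path: "x 0 (Suc i * m) \<le> real (Suc i) * e" if "Suc i < m" for i
    using that
  proof (induction i)
    case 0
    then show ?case using edge[of 0] by simp
  next
    case (Suc i)
    have "x 0 (Suc (Suc i) * m) \<le> x 0 (Suc i * m) + x (Suc i * m) (Suc (Suc i) * m)"
      using V[of 0] V[of "Suc i"] V[of "Suc (Suc i)"] Suc.prems
      by (intro tri) (simp_all del: mult_Suc)
    also have "\<dots> \<le> real (Suc i) * e + e"
      using Suc edge[of "Suc i"] by (intro add_mono) auto
    finally show ?case by (simp add: algebra_simps)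
  qed
  have last: "Suc (m - 2) = m - 1" using m by simp
  have "x 0 ((m - 1) * m) \<le> real (m - 1) * e"
    using path[of "m - 2"] m by (simp only: last)
  moreover have "1 - x 0 ((m - 1) * m) \<le> e"
    using V[of 0] V[of "m - 1"] m
    by (intro neg) (simp_all add: neg_nbrs_def neg_edges_layered)
  ultimately have "1 \<le> real m * e"
    using m by (simp add: of_nat_diff algebra_simps)
  then show ?thesis
    using m by (simp add: e_def field_simps)
qed

text \<open>The same function serves as \<open>y\<close> and \<open>z\<close>, because unit weights
  are unchanged by \<open>powr q\<close>.\<close>

lemma layered_feasible:
  assumes m: "3 \<le> m"
  obtains x y where "feasible q (layered_instance m) x y y"
    "\<And>u. u < m * m \<Longrightarrow> 0 \<le> y u" "\<And>u. u < m * m \<Longrightarrow> y u \<le> 4"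
proof -
  let ?I = "layered_instance m"
  \<comment> \<open>The layers are placed evenly on [0, 1], and \<open>x\<close> is the distance
    there. The first and last layers are at distance 1, so negative edges cost nothing.\<close>
  define x :: "nat \<Rightarrow> nat \<Rightarrow> real"
    where "x u v = \<bar>real (u div m) - real (v div m)\<bar> / real (m - 1)" for u v
  define y where
    "y u = (\<Sum>v\<in>pos_nbrs ?I u. x u v) + (\<Sum>v\<in>neg_nbrs ?I u. 1 - x u v)" for u
  have x01: "0 \<le> x u v" "x u v \<le> 1" if "u < m * m" "v < m * m" for u v
  proof -
    have "u div m \<le> m - 1" "v div m \<le> m - 1"
      using less_mult_imp_div_less[OF that(1)] less_mult_imp_div_less[OF that(2)] by auto
    then have "real (u div m) \<le> real (m - 1)" "real (v div m) \<le> real (m - 1)"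
      unfolding of_nat_le_iff .
    then have "\<bar>real (u div m) - real (v div m)\<bar> \<le> real (m - 1)" by linarith
    then show "0 \<le> x u v" "x u v \<le> 1"
      using m by (auto simp: x_def divide_le_eq)
  qed
  have tri: "x u w \<le> x u v + x v w" for u v w
    unfolding x_def add_divide_distrib[symmetric] by (intro divide_right_mono) auto
  have feas: "feasible q ?I x y y"
    unfolding feasible_def using tri x01
    by (auto simp: y_def) (simp add: x_def abs_minus_commute)
  have y0: "0 \<le> y u" if "u < m * m" for u
    unfolding y_def using that
    by (intro add_nonneg_nonneg sum_nonneg)
      (auto simp: pos_nbrs_def neg_nbrs_def intro!: x01)
  have y4: "y u \<le> 4" if u: "u < m * m" for u
  proof -
    let ?L = "\<lambda>i. {v. v < m * m \<and> v div m = i}"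
    \<comment> \<open>The index \<open>i = m\<close> occurs as the successor of the last layer,
      where the set is empty.\<close>
    have cardL: "card (?L i) \<le> m" for i
    proof (cases "i < m")
      case False
      then have "?L i = {}" using less_mult_imp_div_less[of _ m m] by auto
      then show ?thesis by (simp only: card.empty)
    qed (simp add: card_layer)
    have sub: "pos_nbrs ?I u \<subseteq> ?L (Suc (u div m)) \<union> ?L (u div m - 1)"
      by (auto simp: pos_nbrs_def pos_edges_layered)
    have "card (pos_nbrs ?I u) \<le> card (?L (Suc (u div m)) \<union> ?L (u div m - 1))"
      using sub by (intro card_mono) auto
    also have "\<dots> \<le> card (?L (Suc (u div m))) + card (?L (u div m - 1))"
      by (rule card_Un_le)
    also have "\<dots> \<le> m + m" by (intro add_mono cardL)
    finally have card_pos: "real (card (pos_nbrs ?I u)) \<le> 2 * real m" by linarith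
    have "(\<Sum>v\<in>neg_nbrs ?I u. 1 - x u v) = 0"
      using m by (intro sum.neutral) (auto simp: neg_nbrs_def neg_edges_layered x_def)
    moreover have "(\<Sum>v\<in>pos_nbrs ?I u. x u v) = (\<Sum>v\<in>pos_nbrs ?I u. 1 / real (m - 1))"
      by (intro sum.cong) (auto simp: pos_nbrs_def pos_edges_layered x_def)
    ultimately have "y u = real (card (pos_nbrs ?I u)) / real (m - 1)"
      by (simp add: y_def)
    also have "\<dots> \<le> 2 * real m / real (m - 1)"
      using card_pos by (intro divide_right_mono) auto
    also have "\<dots> \<le> 4"
      using m by (simp add: of_nat_diff divide_le_eq)
    finally show ?thesis .
  qed
  from feas y0 y4 show ?thesis by (rule that)
qed

text \<open>Places the instance among those over which \<open>integrality_gap\<close> takes its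
  supremum. Feasibility of some point matters here, since the infimum must be over a nonempty
  set.\<close>

lemma relaxation_opt_layered_pos:
  assumes m: "3 \<le> m" and q: "1 \<le> q"
  shows "0 < relaxation_opt q (layered_instance m)"
proof -
  let ?S = "{max (lq_norm q {..<m * m} y) ((\<Sum>u<m * m. z u) powr (1 / q)) | x y z.
    feasible q (layered_instance m) x y z}"
  obtain x y where "feasible q (layered_instance m) x y y"
    by (rule layered_feasible[where q = q, OF m])
  then have "?S \<noteq> {}" by blast
  moreover have "1 / real m \<le> a" if a: "a \<in> ?S" for a
  proof -
    obtain x y z where "a = max (lq_norm q {..<m * m} y) ((\<Sum>u<m * m. z u) powr (1 / q))"
      and "feasible q (layered_instance m) x y z"
      using a by blast
    with feasible_layered_ge[OF m q] show ?thesis by (simp add: le_max_iff_disj)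
  qed
  ultimately have "1 / real m \<le> relaxation_opt q (layered_instance m)"
    unfolding relaxation_opt_def verts_layered by (rule cInf_greatest)
  moreover have "0 < 1 / real m" using m by simp
  ultimately show ?thesis by linarith
qed

text \<open>In the even spread each of the \<open>m * m\<close> vertices pays at most 4. This bounds
  the norm of \<open>y\<close> directly, and the term in \<open>z\<close> because
  \<open>4 powr (1 / q)\<close> is at most 4.\<close>

lemma relaxation_opt_layered_le:
  assumes m: "3 \<le> m" and q: "1 \<le> q"
  shows "relaxation_opt q (layered_instance m) \<le> 4 * real m powr (2 / q)"
proof -
  let ?V = "{..<m * m}"
  obtain x y where feas: "feasible q (layered_instance m) x y y"
    and y: "\<And>u. u < m * m \<Longrightarrow> 0 \<le> y u" "\<And>u. u < m * m \<Longrightarrow> y u \<le> 4"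
    by (rule layered_feasible[where q = q, OF m]) (rule that)
  have size: "real (m * m) powr (1 / q) = real m powr (2 / q)"
  proof -
    have "real (m * m) = real m powr 2" using m by (simp add: power2_eq_square)
    then show ?thesis by (simp only: powr_powr) simp
  qed
  have four: "(4 :: real) powr (1 / q) \<le> 4"
    using q powr_mono[of "1 / q" 1 "4 :: real"] by simp
  have "relaxation_opt q (layered_instance m)
      \<le> max (lq_norm q ?V y) ((\<Sum>u\<in>?V. y u) powr (1 / q))"
    unfolding relaxation_opt_def verts_layered
  proof (rule cInf_lower)
    show "bdd_below {max (lq_norm q ?V y) ((\<Sum>u\<in>?V. z u) powr (1 / q)) | x y z.
        feasible q (layered_instance m) x y z}"
      by (rule bdd_belowI[of _ 0]) (auto simp: le_max_iff_disj)
  qed (use feas in blast)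
  also have "\<dots> \<le> 4 * real m powr (2 / q)"
  proof (rule max.boundedI)
    have "(\<Sum>u\<in>?V. \<bar>y u\<bar> powr q) \<le> (\<Sum>u\<in>?V. 4 powr q)"
      using y q by (intro sum_mono powr_mono2) auto
    then have "lq_norm q ?V y \<le> (real (m * m) * 4 powr q) powr (1 / q)"
      unfolding lq_norm_def using q by (intro powr_mono2) (auto intro!: sum_nonneg)
    also have "\<dots> = 4 * real m powr (2 / q)"
      using q by (simp only: powr_mult size powr_powr) simp
    finally show "lq_norm q ?V y \<le> 4 * real m powr (2 / q)" .
  next
    have "(\<Sum>u\<in>?V. y u) \<le> (\<Sum>u\<in>?V. 4)"
      using y by (intro sum_mono) auto
    then have "(\<Sum>u\<in>?V. y u) powr (1 / q) \<le> (real (m * m) * 4) powr (1 / q)"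
      using q y by (intro powr_mono2) (auto intro!: sum_nonneg)
    also have "\<dots> = 4 powr (1 / q) * real m powr (2 / q)"
      by (simp only: powr_mult size mult.commute)
    also have "\<dots> \<le> 4 * real m powr (2 / q)"
      using four by (intro mult_right_mono) auto
    finally show "(\<Sum>u\<in>?V. y u) powr (1 / q) \<le> 4 * real m powr (2 / q)" .
  qed
  finally show ?thesis .
qed

section \<open>The ratio of the two optima\<close>

text \<open>With \<open>n = m * m\<close> the target factor is \<open>m powr (1 - 1 / q)\<close>.
  The constant 1/16 combines the factor 1/4 of the integral bound with the factor 4 of the
  relaxation bound.\<close>

lemma layered_gap:
  assumes m: "3 \<le> m" and q: "1 \<le> q"
  shows "1 / 16 * real (m * m) powr (1 / 2 - 1 / (2 * q)) * relaxation_opt q (layered_instance m)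
      \<le> integral_opt q (layered_instance m)"
proof -
  have "real (m * m) = real m powr 2" using m by (simp add: power2_eq_square)
  then have size: "real (m * m) powr (1 / 2 - 1 / (2 * q)) = real m powr (1 - 1 / q)"
    by (simp only: powr_powr) (simp add: algebra_simps)
  have "1 / 16 * real (m * m) powr (1 / 2 - 1 / (2 * q)) * relaxation_opt q (layered_instance m)
      \<le> 1 / 16 * real m powr (1 - 1 / q) * (4 * real m powr (2 / q))"
    unfolding size by (intro mult_left_mono relaxation_opt_layered_le[OF m q]) simp
  also have "\<dots> = real m powr ((1 - 1 / q) + 2 / q) / 4"
    unfolding powr_add by simp
  also have "(1 - 1 / q) + 2 / q = 1 + 1 / q"
    by (simp add: field_simps)
  also have "real m powr (1 + 1 / q) / 4 \<le> integral_opt q (layered_instance m)"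
    by (rule integral_opt_layered_ge[OF m q])
  finally show ?thesis .
qed

theorem theorem1p4:
  "\<exists>c::real. c > 0 \<and>
     (\<forall>q::real. q \<ge> 1 \<longrightarrow>
       (\<forall>N::nat. \<exists>n\<ge>N.
          integrality_gap q n \<ge> ereal (c * real n powr (1 / 2 - 1 / (2 * q))) \<and>
          (\<exists>I :: nat disagree_instance.
             valid_instance I \<and> card (verts I) = n \<and> relaxation_opt q I > 0 \<and>
             integral_opt q I \<ge> c * real n powr (1 / 2 - 1 / (2 * q)) * relaxation_opt q I)))"
proof (intro exI[of _ "1 / 16"] conjI allI impI)
  fix q :: real and N :: nat
  assume q: "1 \<le> q"
  \<comment> \<open>This gives both \<open>3 \<le> m\<close> and
    \<open>N \<le> m * m\<close>.\<close>
  define m where "m = N + 3"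
  have m: "3 \<le> m" by (simp add: m_def)
  let ?I = "layered_instance m"
  let ?r = "1 / 16 * real (m * m) powr (1 / 2 - 1 / (2 * q))"
  have I: "valid_instance ?I" "card (verts ?I) = m * m" "0 < relaxation_opt q ?I"
    "?r * relaxation_opt q ?I \<le> integral_opt q ?I"
    using valid_layered[OF m] relaxation_opt_layered_pos[OF m q] layered_gap[OF m q] by simp_all
  have "ereal ?r \<le> ereal (integral_opt q ?I / relaxation_opt q ?I)"
    using I(3,4) by (simp only: ereal_less_eq(3) pos_le_divide_eq)
  also have "\<dots> \<le> integrality_gap q (m * m)"
    unfolding integrality_gap_def by (rule SUP_upper) (use I in simp)
  finally have "ereal ?r \<le> integrality_gap q (m * m)" .
  moreover have "N \<le> m * m" by (simp add: m_def algebra_simps)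
  ultimately show "\<exists>n\<ge>N.
      integrality_gap q n \<ge> ereal (1 / 16 * real n powr (1 / 2 - 1 / (2 * q))) \<and>
      (\<exists>I :: nat disagree_instance.
         valid_instance I \<and> card (verts I) = n \<and> relaxation_opt q I > 0 \<and>
         integral_opt q I \<ge> 1 / 16 * real n powr (1 / 2 - 1 / (2 * q)) * relaxation_opt q I)"
    using I by blast
qed simp

end
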